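(* Let $n\ge 2$ and $1\le w\le n-1$ be integers, and let $G=g_0,g_1,\dots,g_{N-1}$ be a cyclic constant-weight Gray code (of weight $w$) of size $N$ for $(1,2,n)$-LRM. Then $n\mid N$.
   Context: Write a binary string of length $n$ as $v=v_0v_1\cdots v_{n-1}$ with indices taken modulo $n$. Let $S(n)=\{0,1\}^n\setminus\{0^n,1^n\}$, and let $S(n,w)$ be the set of binary strings of length $n$ with exactly $w$ ones (weight $w$). For $0\le j\le n-1$, the string $v'=\tau_j(v)$ is given by $v'_j=0$, $v'_{j+1}=1$ (index mod $n$), and $v'_k=v_k$ for all other $k$. A constant-weight Gray code of weight $w$ and size $N\geq 1$ for $(1,2,n)$-LRM ("local rank modulation") is a sequence $G=g_0,\dots,g_{N-1}$ of distinct strings in $S(n,w)$, $1\le w\le n-1$, such that for every $0\le i\le N-2$ there is a $j$ with $g_{i+1}=\tau_j(g_i)$. It is cyclic if in addition $g_0=\tau_j(g_{N-1})$ for some $j$. In every transition (including the one from $g_{N-1}$ to $g_0$) the operation $\tau_j$ is required to change the window in positions $j,j+1$ from $10$ to $01$, i.e. a one is pushed one position to the right, cyclically. *)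

theory Defs
  imports Main
begin

text \<open>Binary strings are lists of type \<^typ>\<open>bool list\<close>, with \<^const>\<open>True\<close> for the bit 1.\<close>

definition weight :: "bool list \<Rightarrow> nat" where
  "weight v = card {i. i < length v \<and> v ! i}"

definition strings :: "nat \<Rightarrow> nat \<Rightarrow> bool list set" where
  "strings n w = {v. length v = n \<and> weight v = w}"

definition tau :: "nat \<Rightarrow> bool list \<Rightarrow> bool list" where
  "tau j v = v[j := False, (j + 1) mod length v := True]"

text \<open>A transition must change the (cyclic) window at positions \<open>j\<close>, \<open>j + 1\<close> from \<open>10\<close> to \<open>01\<close>;
  \<^const>\<open>tau\<close> by itself overwrites any window.\<close>

definition push_right :: "bool list \<Rightarrow> bool list \<Rightarrow> bool" where
  "push_right v v' \<longleftrightarrow>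
     (\<exists>j < length v. v ! j \<and> \<not> v ! ((j + 1) mod length v) \<and> v' = tau j v)"

definition cw_gray_code :: "nat \<Rightarrow> nat \<Rightarrow> nat \<Rightarrow> bool list list \<Rightarrow> bool" where
  "cw_gray_code n w N G \<longleftrightarrow>
     1 \<le> w \<and> w \<le> n - 1 \<and> 1 \<le> N \<and> length G = N \<and>
     distinct G \<and> set G \<subseteq> strings n w \<and>
     (\<forall>i. i + 1 < N \<longrightarrow> push_right (G ! i) (G ! (i + 1)))"

definition cyclic_cw_gray_code :: "nat \<Rightarrow> nat \<Rightarrow> nat \<Rightarrow> bool list list \<Rightarrow> bool" where
  "cyclic_cw_gray_code n w N G \<longleftrightarrow>
     cw_gray_code n w N G \<and> push_right (G ! (N - 1)) (G ! 0)"

end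

(* Each push moves a one from position j to j + 1 modulo n, so the sum of the positions of the
   ones grows by exactly 1 modulo n. After N pushes the code is back at its first string,
   hence N is 0 modulo n. *)

theory Submission
  imports Defs "HOL-Number_Theory.Cong"
begin

definition ones :: "bool list \<Rightarrow> nat set" where
  "ones v = {i. i < length v \<and> v ! i}"

lemma finite_ones [simp]: "finite (ones v)"
  by (simp add: ones_def)

text \<open>Away from the boundary the sum grows by exactly 1; a one wrapping from the last position
  to 0 lowers it by \<open>length v - 1\<close>, which is the same change modulo
  \<open>length v\<close>.\<close>

lemma push_right_sum_ones:
  assumes "push_right v v'"
  shows "[\<Sum>(ones v') = \<Sum>(ones v) + 1] (mod length v)"
proof -
  define n where "n = length v"
  from assms obtain j where j: "j < n" "v ! j" "\<not> v ! ((j + 1) mod n)" "v' = tau j v"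
    by (auto simp: push_right_def n_def)
  define k where "k = (j + 1) mod n"
  have k: "k < n" "\<not> v ! k" "k \<noteq> j"
    using j by (auto simp: k_def)
  have "ones v' = insert k (ones v - {j})"
    using j k by (auto simp: ones_def tau_def n_def k_def nth_list_update split: if_splits)
  moreover have "k \<notin> ones v" "j \<in> ones v"
    using j k by (auto simp: ones_def n_def)
  \<comment> \<open>Both sums are split over the ones that stay put, so no truncated subtraction on
    naturals arises and only \<open>k\<close> and \<open>j + 1\<close> remain to be
    compared.\<close>
  ultimately have "\<Sum>(ones v') = k + \<Sum>(ones v - {j})" "\<Sum>(ones v) = j + \<Sum>(ones v - {j})"
    by (simp_all add: sum.remove)
  moreover have "[k = j + 1] (mod n)"
    by (simp add: k_def cong_def)
  ultimately show ?thesis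
    using cong_add_rcancel_nat[of k "\<Sum>(ones v - {j})" "j + 1" n] by (simp add: n_def add.commute)
qed

theorem theorem4:
  fixes n w N :: nat and G :: "bool list list"
  assumes "n \<ge> 2"
    and "1 \<le> w" and "w \<le> n - 1"
    and "cyclic_cw_gray_code n w N G"
  shows "n dvd N"
proof -
  from assms(4) have N: "1 \<le> N" "length G = N" and G: "set G \<subseteq> strings n w"
    and step: "\<And>i. i + 1 < N \<Longrightarrow> push_right (G ! i) (G ! (i + 1))"
    and last: "push_right (G ! (N - 1)) (G ! 0)"
    by (auto simp: cyclic_cw_gray_code_def cw_gray_code_def)
  have len: "length (G ! i) = n" if "i < N" for i
    using G N that by (auto simp: strings_def dest: nth_mem)
  let ?s = "\<lambda>i. \<Sum>(ones (G ! i))"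
  \<comment> \<open>This accounts for the \<open>N - 1\<close> pushes inside the list; the cyclic
    closing push is added separately.\<close>
  have walk: "[?s i = ?s 0 + i] (mod n)" if "i < N" for i
    using that
  proof (induction i)
    case (Suc i)
    then have "[?s (Suc i) = ?s i + 1] (mod n)"
      using push_right_sum_ones[OF step[of i]] len[of i] by simp
    moreover have "[?s i + 1 = ?s 0 + i + 1] (mod n)"
      using Suc by (intro cong_add) auto
    ultimately show ?case
      by (auto intro: cong_trans)
  qed simp
  have "[?s 0 = ?s (N - 1) + 1] (mod n)"
    using push_right_sum_ones[OF last] len[of "N - 1"] N by simp
  also have "[?s (N - 1) + 1 = ?s 0 + (N - 1) + 1] (mod n)"
    using walk[of "N - 1"] N by (intro cong_add) auto
  \<comment> \<open>Here \<open>1 \<le> N\<close> turns \<open>(N - 1) + 1\<close> into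
    \<open>N\<close>. The added 0 gives both sides the shape for cancelling \<open>?s 0\<close>,
    leaving 0 congruent to \<open>N\<close>.\<close>
  finally have "[?s 0 + 0 = ?s 0 + N] (mod n)"
    using N by simp
  then show ?thesis
    by (simp only: cong_add_lcancel_nat cong_0_iff cong_sym_eq[of 0])
qed

end
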